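(* Let $(G,w)$ be a finite, connected network and let $(X_n)_{n\ge0}$ be the network random walk on $(G,w)$ with an arbitrary initial distribution. For each edge $e\in E(G)$ and $n\ge 0$, let $$C_e^n:=\#\bigl\{j : 0\le j\le n-1,\ \{X_j,X_{j+1}\}=e\bigr\}$$ be the total number of crossings of $e$, in both directions, up to time $n$. Let $T$ be a random time (a nonnegative-integer-valued random variable) independent of the random walk, and let $\tau$ be a finite stopping time such that $$\{\tau=n\}\in\sigma\bigl(T,\ C_e^n : e\in E(G)\bigr)\qquad\text{for all } n\ge 0 .$$ Then $F\bigl((X_0,\ldots,X_\tau)\bigr)$ and $L\bigl((X_0,\ldots,X_\tau)\bigr)$ have the same distribution.
   Context: A finite connected network $(G,w)$ is a finite connected simple graph $G=(V,E)$ with weights $w\colon E\to(0,\infty)$. Write $w(x)$ for the sum of $w(e)$ over all edges $e$ incident to $x$, and $x\sim y$ if $\{x,y\}\in E$. The network random walk is the Markov chain on $V$ with transition probabilities $p(x,y)=\frac{w(x,y)}{w(x)}\mathbf 1_{\{x\sim y\}}$. The stopping time $\tau$ may depend on the extra randomness $T$ in addition to the walk. A path of length $n$ is a sequence $\gamma=(v_0,\dots,v_n)$ of vertices with $v_{i-1}\sim v_i$ for $1\le i\le n$; let $V(\gamma)=\{v_0,\dots,v_n\}$. First-entrance operator $F$: for $u\in V(\gamma)\setminus\{v_0\}$, let $i\ge1$ be the smallest index with $v_i=u$; the first-entrance edge to $u$ is $\{v_{i-1},v_i\}$. $F(\gamma)$ is the subtree of $G$ (with vertex set $V(\gamma)$)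 formed by the first-entrance edges to all vertices of $V(\gamma)\setminus\{v_0\}$. Last-exit operator $L$: for $u\in V(\gamma)\setminus\{v_n\}$, let $i\le n-1$ be the largest index with $v_i=u$; the last-exit edge of $u$ is $\{v_i,v_{i+1}\}$. $L(\gamma)$ is the subtree of $G$ (with vertex set $V(\gamma)$) formed by the last-exit edges of all vertices of $V(\gamma)\setminus\{v_n\}$. Both $F(\gamma)$ and $L(\gamma)$ are regarded as unoriented, unrooted subtrees of $G$. *)

theory Defs
  imports "HOL-Probability.Probability" "HOL-Library.Extended_Nat"
begin

text \<open>
  A finite connected network: edges are two-element sets of vertices (so the graph is simple
  and unoriented), and weights are only constrained on edges.
\<close>

locale network =
  fixes V :: "'v set" and E :: "'v set set" and w :: "'v set \<Rightarrow> real"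
  assumes finite_V: "finite V"
    and V_nonempty: "V \<noteq> {}"
    and edges: "e \<in> E \<Longrightarrow> \<exists>x y. x \<in> V \<and> y \<in> V \<and> x \<noteq> y \<and> e = {x, y}"
    and connected: "\<lbrakk>x \<in> V; y \<in> V\<rbrakk> \<Longrightarrow> (x, y) \<in> {(u, v). {u, v} \<in> E}\<^sup>*"
    and weight_pos: "e \<in> E \<Longrightarrow> 0 < w e"

definition vertex_weight :: "'v set set \<Rightarrow> ('v set \<Rightarrow> real) \<Rightarrow> 'v \<Rightarrow> real" where
  "vertex_weight E w x = (\<Sum>e\<in>{e \<in> E. x \<in> e}. w e)"

definition transition_prob :: "'v set set \<Rightarrow> ('v set \<Rightarrow> real) \<Rightarrow> 'v \<Rightarrow> 'v \<Rightarrow> real" where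
  "transition_prob E w x y = (if {x, y} \<in> E then w {x, y} / vertex_weight E w x else 0)"

text \<open>
  The law of \<open>X 0\<close> is unconstrained. The positivity guard in \<open>markov\<close> is
  needed because \<open>cond_prob\<close> is \<open>0\<close> when conditioning on a null event.
\<close>

locale network_walk = network V E w + prob_space M
  for V :: "'v set" and E :: "'v set set" and w :: "'v set \<Rightarrow> real" and M :: "'a measure" +
  fixes X :: "nat \<Rightarrow> 'a \<Rightarrow> 'v"
  assumes measurable_X: "X n \<in> M \<rightarrow>\<^sub>M count_space V"
    and markov: "\<lbrakk>\<And>i. i \<le> n \<Longrightarrow> x i \<in> V; y \<in> V; \<P>(\<omega> in M. \<forall>i\<le>n. X i \<omega> = x i) > 0\<rbrakk> \<Longrightarrow>
      \<P>(\<omega> in M. X (Suc n) \<omega> = y \<bar> \<forall>i\<le>n. X i \<omega> = x i) = transition_prob E w (x n) y"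

definition crossings :: "(nat \<Rightarrow> 'a \<Rightarrow> 'v) \<Rightarrow> 'v set \<Rightarrow> nat \<Rightarrow> 'a \<Rightarrow> nat" where
  "crossings X e n \<omega> = card {j. j < n \<and> {X j \<omega>, X (Suc j) \<omega>} = e}"

text \<open>The sigma-algebra generated by \<open>T\<close> and the crossing counts \<open>C\<^sub>e\<^sup>n\<close>, \<open>e \<in> E\<close>.\<close>

definition crossing_algebra ::
  "'a measure \<Rightarrow> 'v set set \<Rightarrow> (nat \<Rightarrow> 'a \<Rightarrow> 'v) \<Rightarrow> ('a \<Rightarrow> nat) \<Rightarrow> nat \<Rightarrow> 'a measure" where
  "crossing_algebra M E X T n = sigma (space M)
     ({T -` A \<inter> space M |A. True} \<union> {crossings X e n -` A \<inter> space M |e A. e \<in> E})"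

text \<open>
  The filtration of the walk enlarged by \<open>T\<close>, indexed by \<open>enat\<close> so that stopping times may
  take the value \<open>\<infinity>\<close>.
\<close>

definition walk_filtration ::
  "'a measure \<Rightarrow> (nat \<Rightarrow> 'a \<Rightarrow> 'v) \<Rightarrow> ('a \<Rightarrow> nat) \<Rightarrow> enat \<Rightarrow> 'a measure" where
  "walk_filtration M X T t = sigma (space M)
     ({T -` A \<inter> space M |A. True} \<union> {X i -` A \<inter> space M |i A. enat i \<le> t})"

definition independent_of_walk ::
  "'a measure \<Rightarrow> 'v set \<Rightarrow> (nat \<Rightarrow> 'a \<Rightarrow> 'v) \<Rightarrow> ('a \<Rightarrow> nat) \<Rightarrow> bool" where
  "independent_of_walk M V X T \<longleftrightarrow> prob_space.indep_set M
     (sets (vimage_algebra (space M) T (count_space UNIV)))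
     (sets (vimage_algebra (space M) (\<lambda>\<omega> i. X i \<omega>) (\<Pi>\<^sub>M i\<in>UNIV. count_space V)))"

text \<open>
  A path \<open>(v\<^sub>0, \<dots>, v\<^sub>n)\<close> is the list of its \<open>n + 1\<close> vertices. An unoriented, unrooted
  subgraph is a pair of a vertex set and an edge set.
\<close>

type_synonym 'v subgraph = "'v set \<times> 'v set set"

definition first_entrance_edge :: "'v list \<Rightarrow> 'v \<Rightarrow> 'v set" where
  "first_entrance_edge \<gamma> u =
     (let i = (LEAST i. 1 \<le> i \<and> i < length \<gamma> \<and> \<gamma> ! i = u) in {\<gamma> ! (i - 1), \<gamma> ! i})"

definition first_entrance_tree :: "'v list \<Rightarrow> 'v subgraph" where
  "first_entrance_tree \<gamma> = (set \<gamma>, first_entrance_edge \<gamma> ` (set \<gamma> - {hd \<gamma>}))"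

definition last_exit_edge :: "'v list \<Rightarrow> 'v \<Rightarrow> 'v set" where
  "last_exit_edge \<gamma> u =
     (let i = (GREATEST i. Suc i < length \<gamma> \<and> \<gamma> ! i = u) in {\<gamma> ! i, \<gamma> ! Suc i})"

definition last_exit_tree :: "'v list \<Rightarrow> 'v subgraph" where
  "last_exit_tree \<gamma> = (set \<gamma>, last_exit_edge \<gamma> ` (set \<gamma> - {last \<gamma>}))"

text \<open>
  The path \<open>(X\<^sub>0, \<dots>, X\<^sub>\<tau>)\<close>. Only meaningful where \<open>\<tau>\<close> is finite: \<open>the_enat \<infinity>\<close> is an
  unspecified natural number.
\<close>

definition stopped_path :: "(nat \<Rightarrow> 'a \<Rightarrow> 'v) \<Rightarrow> ('a \<Rightarrow> enat) \<Rightarrow> 'a \<Rightarrow> 'v list" where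
  "stopped_path X \<tau> \<omega> = map (\<lambda>i. X i \<omega>) [0..<Suc (the_enat (\<tau> \<omega>))]"

end

theory Submission
  imports Defs
begin

text \<open>
  Record a path from \<open>a\<close> to \<open>b\<close> by the stacks of successive exits from its vertices. The last
  exits, from all vertices but \<open>b\<close>, are the edges of \<open>L(\<gamma>)\<close> oriented towards \<open>b\<close>. Orient that tree
  towards \<open>a\<close> instead, keep all other exits, and follow the new stacks from \<open>b\<close>. Re-rooting the
  tree changes the in- and out-degrees exactly so that this walk uses up every stack and ends at
  \<open>a\<close>; its reversal \<open>\<gamma>'\<close> is a path from \<open>a\<close> to \<open>b\<close> with the same edge crossings as \<open>\<gamma>\<close> and
  \<open>F(\<gamma>') = L(\<gamma>)\<close>. The construction is an involution up to reversal, hence a bijection on paths.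
  The probability that the walk starts with a given path depends only on its endpoints, its
  vertex visits and its crossings, and given the crossings the event of stopping there depends only
  on \<open>T\<close>. So \<open>\<gamma>\<close> and \<open>\<gamma>'\<close> are equally likely to be the stopped path.
\<close>

section \<open>Paths and their exit stacks\<close>

text \<open>Exits are listed in order of time: the head is the next move out of \<open>u\<close>,
  and the last entry is the far end of its last-exit edge.\<close>

fun exits :: "'v list \<Rightarrow> 'v \<Rightarrow> 'v list" where
  "exits (x # y # \<gamma>) u = (if x = u then y # exits (y # \<gamma>) u else exits (y # \<gamma>) u)"
| "exits _ u = []"

fun edge_list :: "'v list \<Rightarrow> 'v set list" where
  "edge_list (x # y # \<gamma>) = {x, y} # edge_list (y # \<gamma>)"
| "edge_list _ = []"

lemma exits_notin: "u \<notin> set \<gamma> \<Longrightarrow> exits \<gamma> u = []"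
  by (induction \<gamma> u rule: exits.induct) auto

lemma set_exits_subset: "set (exits \<gamma> u) \<subseteq> set \<gamma>"
  by (induction \<gamma> u rule: exits.induct) auto

lemma exits_append: "exits (xs @ x # ys) u = exits (xs @ [x]) u @ exits (x # ys) u"
proof (induction xs)
  case (Cons a xs)
  then show ?case by (cases xs) auto
qed simp

text \<open>Each visit to \<open>u\<close> is followed by exactly one exit, except the visit that
  ends the path.\<close>

lemma count_list_eq_exits:
  "\<gamma> \<noteq> [] \<Longrightarrow> count_list \<gamma> u = length (exits \<gamma> u) + of_bool (u = last \<gamma>)"
  by (induction \<gamma> u rule: exits.induct) auto

lemma exits_neq_Nil:
  assumes "u \<in> set \<gamma>" "u \<noteq> last \<gamma>"
  shows "exits \<gamma> u \<noteq> []"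
proof -
  have "\<gamma> \<noteq> []" using assms(1) by auto
  from count_list_eq_exits[OF this, of u] assms show ?thesis
    by (auto simp: count_list_0_iff)
qed

text \<open>Every position but the first is the target of exactly one exit. With
  \<open>count_list_eq_exits\<close> this balances in- and out-degrees.\<close>

lemma mset_eq_sum_exits:
  assumes "finite S" "\<gamma> \<noteq> []" "set \<gamma> \<subseteq> S"
  shows "mset \<gamma> = (\<Sum>v\<in>S. mset (exits \<gamma> v)) + {#hd \<gamma>#}"
  using assms(2,3)
proof (induction \<gamma> rule: edge_list.induct)
  case (1 x y \<gamma>)
  have "(\<Sum>v\<in>S. mset (exits (x # y # \<gamma>) v))
      = (\<Sum>v\<in>S. (if v = x then {#y#} else {#}) + mset (exits (y # \<gamma>) v))"
    by (rule sum.cong) auto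
  also have "\<dots> = {#y#} + (\<Sum>v\<in>S. mset (exits (y # \<gamma>) v))"
    using 1 assms(1) by (simp add: sum.distrib sum.delta)
  finally show ?case using 1 by simp
qed auto

lemma mset_edge_list:
  assumes "finite S" "set \<gamma> \<subseteq> S"
  shows "mset (edge_list \<gamma>) = (\<Sum>u\<in>S. image_mset (\<lambda>v. {u, v}) (mset (exits \<gamma> u)))"
  using assms(2)
proof (induction \<gamma> rule: edge_list.induct)
  case (1 x y \<gamma>)
  have "(\<Sum>u\<in>S. image_mset (\<lambda>v. {u, v}) (mset (exits (x # y # \<gamma>) u)))
      = (\<Sum>u\<in>S. (if u = x then {#{x, y}#} else {#})
          + image_mset (\<lambda>v. {u, v}) (mset (exits (y # \<gamma>) u)))"
    by (rule sum.cong) auto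
  also have "\<dots> = {#{x, y}#} + (\<Sum>u\<in>S. image_mset (\<lambda>v. {u, v}) (mset (exits (y # \<gamma>) u)))"
    using 1 assms(1) by (simp add: sum.distrib sum.delta)
  finally show ?case using 1 by simp
qed auto

text \<open>The next vertex is always the head of the current vertex's stack, and the path ends on
  meeting an empty stack.\<close>

lemma path_determined_by_exits:
  assumes "\<gamma> \<noteq> []" "\<gamma>' \<noteq> []" "hd \<gamma> = hd \<gamma>'" "exits \<gamma> = exits \<gamma>'"
  shows "\<gamma> = \<gamma>'"
  using assms
proof (induction \<gamma> arbitrary: \<gamma>' rule: edge_list.induct)
  case (1 x y \<gamma>)
  have e: "exits (x # y # \<gamma>) u = exits \<gamma>' u" for u by (rule fun_cong[OF 1(5)])
  have "exits \<gamma>' x \<noteq> []" using e[of x] by auto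
  with 1(3,4) obtain z \<delta> where \<gamma>': "\<gamma>' = x # z # \<delta>"
    by (cases \<gamma>' rule: edge_list.cases) auto
  have z: "z = y" using e[of x] by (simp add: \<gamma>')
  have "exits (y # \<gamma>) u = exits (z # \<delta>) u" for u
    using e[of u] by (auto simp: \<gamma>' split: if_splits)
  then have "y # \<gamma> = z # \<delta>" using z by (intro "1.IH") auto
  then show ?case by (simp add: \<gamma>')
next
  case ("2_2" v)
  from "2_2"(4) have "exits \<gamma>' v = []" by (metis exits.simps(3))
  with "2_2" show ?case by (cases \<gamma>' rule: edge_list.cases) auto
qed auto

text \<open>
  Following the stacks \<open>s\<close> of exits from \<open>a\<close>: the flow condition forces the path to stop at \<open>b\<close>
  only, and the last exits, which decrease \<open>d\<close>, guarantee that every stack is used up.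
\<close>

lemma path_with_exits:
  fixes s :: "'v \<Rightarrow> 'v list" and d :: "'v \<Rightarrow> nat"
  assumes "finite S" "\<And>u. u \<notin> S \<Longrightarrow> s u = []"
    and "\<And>u. length (s u) + of_bool (u = b) = count (\<Sum>v\<in>S. mset (s v)) u + of_bool (u = a)"
    and "\<And>u. s u \<noteq> [] \<Longrightarrow> u \<noteq> b \<Longrightarrow> d (last (s u)) < d u"
  shows "\<exists>\<gamma>. \<gamma> \<noteq> [] \<and> hd \<gamma> = a \<and> last \<gamma> = b \<and> exits \<gamma> = s"
  using assms
proof (induction "\<Sum>v\<in>S. length (s v)" arbitrary: s a rule: less_induct)
  case less
  note fin = less(2) and supp = less(3) and flow = less(4) and rank = less(5)
  have count_pos: "count (\<Sum>v\<in>S. mset (s v)) v \<ge> 1" if "v \<in> set (s u)" for u v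
  proof -
    have "u \<in> S" using supp[of u] that by (metis empty_iff empty_set)
    then have "(\<Sum>v\<in>S. mset (s v)) = mset (s u) + (\<Sum>v\<in>S - {u}. mset (s v))"
      using fin by (simp add: sum.remove)
    with that show ?thesis by (simp add: Suc_le_eq)
  qed
  show ?case
  proof (cases "s a")
    case Nil
    \<comment> \<open>With \<open>s a\<close> empty, the left side of the flow equation at
      \<open>a\<close> is at most 1 and the right side at least 1, so both are 1.\<close>
    have ab: "a = b" and no: "count (\<Sum>v\<in>S. mset (s v)) a = 0"
      using flow[of a] Nil by (auto simp: of_bool_def split: if_splits)
    \<comment> \<open>The last target on a nonempty stack has smaller rank, hence an empty stack. It
      is entered at least once, but with \<open>a = b\<close> the flow equation there allows no
      entry.\<close>
    have "s u = []" for u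
    proof (induction "d u" arbitrary: u rule: less_induct)
      case less
      show ?case
      proof (rule ccontr)
        assume ne: "s u \<noteq> []"
        then have "u \<noteq> b" using Nil ab by auto
        let ?v = "last (s u)"
        have "s ?v = []" using less rank ne \<open>u \<noteq> b\<close> by blast
        moreover have "count (\<Sum>v\<in>S. mset (s v)) ?v \<ge> 1" using ne by (intro count_pos[of _ u]) auto
        ultimately show False using flow[of ?v] ab by (simp add: count_eq_zero_iff)
      qed
    qed
    then have "exits [a] = s" by auto
    with ab show ?thesis by (intro exI[of _ "[a]"]) auto
  next
    case (Cons v r)
    \<comment> \<open>The walk takes the exit to \<open>v\<close>. Popping it keeps the last entry
      of a stack that stays nonempty, so \<open>d\<close> still serves.\<close>
    let ?s = "s(a := r)"
    have a: "a \<in> S" using supp[of a] Cons by auto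
    have "(\<Sum>u\<in>S. mset (s u)) = mset (s a) + (\<Sum>u\<in>S - {a}. mset (s u))"
      using fin a by (simp add: sum.remove)
    moreover have "(\<Sum>u\<in>S. mset (?s u)) = mset (?s a) + (\<Sum>u\<in>S - {a}. mset (?s u))"
      using fin a by (rule sum.remove)
    moreover have "(\<Sum>u\<in>S - {a}. mset (?s u)) = (\<Sum>u\<in>S - {a}. mset (s u))"
      by (rule sum.cong) auto
    ultimately have m: "(\<Sum>u\<in>S. mset (s u)) = {#v#} + (\<Sum>u\<in>S. mset (?s u))"
      using Cons by simp
    have "(\<Sum>u\<in>S. length (?s u)) < (\<Sum>u\<in>S. length (s u))"
      using fin a Cons by (intro sum_strict_mono_ex1) auto
    moreover have "length (?s u) + of_bool (u = b)
        = count (\<Sum>v\<in>S. mset (?s v)) u + of_bool (u = v)" for u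
      using flow[of u] Cons unfolding m by (auto simp: of_bool_def split: if_splits)
    moreover have "?s u = []" if "u \<notin> S" for u
      using supp that a by auto
    moreover have "d (last (?s u)) < d u" if "?s u \<noteq> []" "u \<noteq> b" for u
      using rank[of u] that Cons by (auto split: if_splits)
    ultimately obtain \<gamma> where \<gamma>: "\<gamma> \<noteq> []" "hd \<gamma> = v" "last \<gamma> = b" "exits \<gamma> = ?s"
      using less(1)[of ?s v] fin by blast
    then obtain \<delta> where \<delta>: "\<gamma> = v # \<delta>" by (cases \<gamma>) auto
    have "exits (a # \<gamma>) u = s u" for u
      using fun_cong[OF \<gamma>(4), of u] Cons unfolding \<delta> by (auto split: if_splits)
    then have "exits (a # \<gamma>) = s" by auto
    with \<gamma> show ?thesis by (intro exI[of _ "a # \<gamma>"]) auto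
  qed
qed

section \<open>Re-rooting trees\<close>

text \<open>The rank \<open>d\<close> certifies that iterating \<open>p\<close> from any vertex of \<open>S\<close> leads to the root \<open>r\<close>.\<close>

definition parent_map :: "'v set \<Rightarrow> 'v \<Rightarrow> ('v \<Rightarrow> 'v) \<Rightarrow> ('v \<Rightarrow> nat) \<Rightarrow> bool" where
  "parent_map S r p d \<longleftrightarrow> (\<forall>u\<in>S - {r}. p u \<in> S \<and> d (p u) < d u)"

text \<open>A multiset, so that it can be added to the crossings made along the inner exits.\<close>

definition parent_edges :: "'v set \<Rightarrow> 'v \<Rightarrow> ('v \<Rightarrow> 'v) \<Rightarrow> 'v set multiset" where
  "parent_edges S r p = image_mset (\<lambda>u. {u, p u}) (mset_set (S - {r}))"

text \<open>The root moves along one edge at a time. The degrees in the tree stay fixed, and every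
  vertex but the root has out-degree 1; the third conclusion is the resulting identity of
  in-degrees.\<close>

lemma parent_map_reroot:
  assumes "finite S" "parent_map S b p d" "b \<in> S" "x \<in> S"
  shows "\<exists>p' d'. parent_map S x p' d' \<and> parent_edges S x p' = parent_edges S b p \<and>
    image_mset p' (mset_set (S - {x})) + {#b#} = image_mset p (mset_set (S - {b})) + {#x#}"
  using assms(4)
proof (induction "d x" arbitrary: x rule: less_induct)
  case less
  show ?case
  proof (cases "x = b")
    case True
    then show ?thesis using assms(2) by blast
  next
    case False
    define z where "z = p x"
    have z: "z \<in> S" "d z < d x" using assms(2) less(2) False by (auto simp: z_def parent_map_def)
    from less(1)[OF z(2,1)] obtain p' d' where IH: "parent_map S z p' d'"
      "parent_edges S z p' = parent_edges S b p"
      "image_mset p' (mset_set (S - {z})) + {#b#} = image_mset p (mset_set (S - {b})) + {#z#}"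
      by blast
    have "x \<noteq> z" using z by auto
    \<comment> \<open>The root \<open>z\<close> has no parent, so the surviving edge between
      \<open>x\<close> and \<open>z\<close> must be directed from \<open>x\<close> to
      \<open>z\<close>.\<close>
    have "{x, z} \<in># parent_edges S z p'"
      unfolding IH(2) using assms(1) less(2) False by (auto simp: parent_edges_def z_def)
    then obtain u where "u \<in> S - {z}" "{x, z} = {u, p' u}"
      using assms(1) by (auto simp: parent_edges_def)
    then have p'x: "p' x = z" by (auto simp: doubleton_eq_iff)
    \<comment> \<open>Reversing this single edge makes \<open>x\<close> the root. Rank 0 at
      \<open>x\<close> and a shift by one elsewhere let any vertex point to
      \<open>x\<close>.\<close>
    define q where "q = p'(z := x)"
    have "parent_map S x q (\<lambda>u. if u = x then 0 else Suc (d' u))"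
      using IH(1) less(2) by (auto simp: parent_map_def q_def)
    define R where "R = mset_set (S - {x, z})"
    have R: "mset_set (S - {x}) = add_mset z R" "mset_set (S - {z}) = add_mset x R"
    proof -
      have "S - {x} = insert z (S - {x, z})" "S - {z} = insert x (S - {x, z})"
        using \<open>x \<noteq> z\<close> z less(2) by auto
      then show "mset_set (S - {x}) = add_mset z R" "mset_set (S - {z}) = add_mset x R"
        unfolding R_def using assms(1)
        by (metis (no_types, lifting) Diff_iff finite_Diff insertCI mset_set.insert)+
    qed
    have "image_mset q R = image_mset p' R"
      by (rule image_mset_cong) (use assms(1) in \<open>auto simp: R_def q_def\<close>)
    then have "image_mset q (mset_set (S - {x})) + {#z#} = image_mset p' (mset_set (S - {z})) + {#x#}"
      by (simp add: R p'x q_def)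
    then have "image_mset q (mset_set (S - {x})) + {#b#} + {#z#}
      = image_mset p (mset_set (S - {b})) + {#x#} + {#z#}"
      using IH(3) by (metis (no_types, lifting) union_assoc union_commute)
    then have "image_mset q (mset_set (S - {x})) + {#b#} = image_mset p (mset_set (S - {b})) + {#x#}"
      by simp
    moreover have "parent_edges S x q = parent_edges S z p'"
    proof -
      have "image_mset (\<lambda>u. {u, q u}) R = image_mset (\<lambda>u. {u, p' u}) R"
        by (rule image_mset_cong) (use assms(1) in \<open>auto simp: R_def q_def\<close>)
      then show ?thesis unfolding parent_edges_def R by (simp add: p'x q_def insert_commute)
    qed
    ultimately show ?thesis using \<open>parent_map S x q _\<close> IH(2) by metis
  qed
qed

text \<open>If \<open>p u \<noteq> p' u\<close>, then \<open>p'\<close> produces the edge {u, p u}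
  from its other end, so \<open>p'\<close> maps \<open>p u\<close> to \<open>u\<close>. Induction on
  the rank then gives \<open>p\<close> a two-cycle, which \<open>d\<close> excludes.\<close>

lemma parent_map_unique:
  assumes "parent_map S r p d" "parent_map S r p' d'"
    and "(\<lambda>u. {u, p u}) ` (S - {r}) = (\<lambda>u. {u, p' u}) ` (S - {r})"
    and "u \<in> S - {r}"
  shows "p u = p' u"
  using assms(4)
proof (induction "d u" arbitrary: u rule: less_induct)
  case less
  show ?case
  proof (rule ccontr)
    assume ne: "p u \<noteq> p' u"
    from less(2) assms(3) obtain v where v: "v \<in> S - {r}" "{u, p u} = {v, p' v}" by blast
    with ne have v': "v = p u" "p' v = u" by (auto simp: doubleton_eq_iff)
    have "d v < d u" using assms(1) less(2) v' by (auto simp: parent_map_def)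
    with less(1) v v' have "p v = u" by simp
    moreover have "d (p v) < d v" using assms(1) v(1) by (auto simp: parent_map_def)
    ultimately show False using \<open>d v < d u\<close> by simp
  qed
qed

section \<open>Last-exit trees\<close>

text \<open>The target of a last exit is visited after the last visit to its source, so following
  last exits cannot cycle and leads to \<open>last \<gamma>\<close>.\<close>

lemma parent_map_last_exits:
  assumes "\<gamma> \<noteq> []"
  shows "\<exists>d. parent_map (set \<gamma>) (last \<gamma>) (\<lambda>u. last (exits \<gamma> u)) d"
  using assms
proof (induction \<gamma> rule: edge_list.induct)
  case (1 x y \<gamma>)
  then obtain d where d: "parent_map (set (y # \<gamma>)) (last (y # \<gamma>)) (\<lambda>u. last (exits (y # \<gamma>) u)) d"
    by blast
  \<comment> \<open>Prepending \<open>x\<close> changes no last exit of a vertex that occurs later.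
    If \<open>x\<close> is new to the path, it becomes a leaf attached to \<open>y\<close>, ranked
    just above it.\<close>
  define e where "e = (if x \<in> set (y # \<gamma>) then d else d(x := Suc (d y)))"
  have "last (exits (x # y # \<gamma>) u) \<in> set (x # y # \<gamma>) \<and> e (last (exits (x # y # \<gamma>) u)) < e u"
    if u: "u \<in> set (x # y # \<gamma>) - {last (x # y # \<gamma>)}" for u
  proof (cases "u \<in> set (y # \<gamma>)")
    case True
    with u have ne: "exits (y # \<gamma>) u \<noteq> []" by (intro exits_neq_Nil) auto
    then have "last (exits (x # y # \<gamma>) u) = last (exits (y # \<gamma>) u)" by auto
    moreover have "last (exits (y # \<gamma>) u) \<in> set (y # \<gamma>)" "d (last (exits (y # \<gamma>) u)) < d u"
      using d True u unfolding parent_map_def by (metis DiffI Diff_iff last_ConsR list.discI)+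
    ultimately show ?thesis using True by (auto simp: e_def)
  next
    case False
    with u have "u = x" "exits (y # \<gamma>) u = []" by (auto intro: exits_notin)
    with False show ?thesis by (auto simp: e_def)
  qed
  then show ?case unfolding parent_map_def by blast
qed (auto simp: parent_map_def)

lemma split_at_last_exit:
  assumes "u \<in> set \<gamma>" "u \<noteq> last \<gamma>"
  obtains xs v ys where "\<gamma> = xs @ u # v # ys" "u \<notin> set (v # ys)"
proof -
  obtain xs zs where *: "\<gamma> = xs @ u # zs" "u \<notin> set zs"
    using split_list_last[OF assms(1)] by blast
  then show thesis using that assms(2) by (cases zs) auto
qed

lemma last_exit_edge_eq:
  assumes "u \<notin> set (v # ys)"
  shows "last_exit_edge (xs @ u # v # ys) u = {u, v}"
proof -
  let ?\<gamma> = "xs @ u # v # ys"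
  have "(GREATEST i. Suc i < length ?\<gamma> \<and> ?\<gamma> ! i = u) = length xs"
  proof (rule Greatest_equality)
    fix i assume i: "Suc i < length ?\<gamma> \<and> ?\<gamma> ! i = u"
    show "i \<le> length xs"
    proof (rule ccontr)
      assume "\<not> i \<le> length xs"
      then obtain j where "i = length xs + Suc j" by (metis add_Suc_right less_imp_Suc_add not_le)
      with i have "(v # ys) ! j = u" "j < length (v # ys)" by (auto simp: nth_append)
      with assms show False by (metis nth_mem)
    qed
  qed auto
  then show ?thesis by (simp add: last_exit_edge_def Let_def nth_append)
qed

lemma first_entrance_edge_eq:
  assumes "u \<notin> set (ys @ [v])"
  shows "first_entrance_edge (ys @ v # u # xs) u = {u, v}"
proof -
  let ?\<gamma> = "ys @ v # u # xs"
  have "(LEAST i. 1 \<le> i \<and> i < length ?\<gamma> \<and> ?\<gamma> ! i = u) = Suc (length ys)"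
  proof (rule Least_equality)
    fix i assume i: "1 \<le> i \<and> i < length ?\<gamma> \<and> ?\<gamma> ! i = u"
    show "Suc (length ys) \<le> i"
    proof (rule ccontr)
      assume "\<not> Suc (length ys) \<le> i"
      then have "i < length (ys @ [v])" by simp
      moreover have "(ys @ [v]) ! i = u"
        using i calculation by (auto simp: nth_append less_Suc_eq)
      ultimately show False using assms by (metis nth_mem)
    qed
  qed (auto simp: nth_append)
  then show ?thesis by (simp add: first_entrance_edge_def Let_def nth_append insert_commute)
qed

lemma last_exit_edge_exits:
  assumes "u \<in> set \<gamma>" "u \<noteq> last \<gamma>"
  shows "last_exit_edge \<gamma> u = {u, last (exits \<gamma> u)}"
proof -
  obtain xs v ys where *: "\<gamma> = xs @ u # v # ys" "u \<notin> set (v # ys)"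
    using assms by (rule split_at_last_exit)
  then have "exits (v # ys) u = []" by (intro exits_notin)
  then have "last (exits \<gamma> u) = v"
    unfolding * by (subst exits_append) simp
  then show ?thesis using last_exit_edge_eq[OF *(2), of xs] by (simp add: *(1))
qed

text \<open>Reversing time turns the last exit from \<open>u\<close> into the first entrance to
  \<open>u\<close>, along the same unoriented edge.\<close>

lemma first_entrance_tree_rev:
  assumes "\<gamma> \<noteq> []"
  shows "first_entrance_tree (rev \<gamma>) = last_exit_tree \<gamma>"
proof -
  have "first_entrance_edge (rev \<gamma>) u = last_exit_edge \<gamma> u" if "u \<in> set \<gamma> - {last \<gamma>}" for u
  proof -
    obtain xs v ys where *: "\<gamma> = xs @ u # v # ys" "u \<notin> set (v # ys)"
      using \<open>u \<in> _\<close> by (auto elim: split_at_last_exit)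
    then show ?thesis
      using last_exit_edge_eq[OF *(2), of xs] first_entrance_edge_eq[of u "rev ys" v "rev xs"] by auto
  qed
  then show ?thesis
    by (simp add: first_entrance_tree_def last_exit_tree_def hd_rev)
qed

lemma last_exit_tree_exits:
  "last_exit_tree \<gamma> = (set \<gamma>, (\<lambda>u. {u, last (exits \<gamma> u)}) ` (set \<gamma> - {last \<gamma>}))"
  by (auto simp: last_exit_tree_def last_exit_edge_exits image_iff)

text \<open>The number kept is the whole stack height at the final vertex and one less at any other
  visited vertex, so only the exits of the last-exit tree are dropped. The formula does not name the
  end of the path, which changes under rerouting.\<close>

definition inner_exits :: "'v list \<Rightarrow> 'v \<Rightarrow> 'v list" where
  "inner_exits \<gamma> u = take (count_list \<gamma> u - 1) (exits \<gamma> u)"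

lemma exits_eq_inner_exits:
  assumes "\<gamma> \<noteq> []"
  shows "exits \<gamma> u
    = inner_exits \<gamma> u @ (if u \<in> set \<gamma> - {last \<gamma>} then [last (exits \<gamma> u)] else [])"
proof (cases "u \<in> set \<gamma> - {last \<gamma>}")
  case True
  then have "exits \<gamma> u \<noteq> []" by (intro exits_neq_Nil) auto
  moreover have "inner_exits \<gamma> u = butlast (exits \<gamma> u)"
    using True count_list_eq_exits[OF assms, of u] by (auto simp: inner_exits_def butlast_conv_take)
  ultimately show ?thesis using True by simp
next
  case False
  then show ?thesis
    using count_list_eq_exits[OF assms, of u] by (auto simp: inner_exits_def exits_notin)
qed

lemma length_inner_exits: "length (inner_exits \<gamma> u) = count_list \<gamma> u - 1"
proof (cases "\<gamma> = []")
  case False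
  then show ?thesis using count_list_eq_exits[of \<gamma> u] by (auto simp: inner_exits_def)
qed (simp add: inner_exits_def)

section \<open>Rerouting a path\<close>

text \<open>Here \<open>\<gamma>'\<close> runs from the end of \<open>\<gamma>\<close> to its start,
  before the final reversal; in this form the relation is symmetric.\<close>

definition rerouted :: "'v list \<Rightarrow> 'v list \<Rightarrow> bool" where
  "rerouted \<gamma> \<gamma>' \<longleftrightarrow> \<gamma> \<noteq> [] \<and> \<gamma>' \<noteq> [] \<and> hd \<gamma>' = last \<gamma> \<and> last \<gamma>' = hd \<gamma> \<and>
     mset \<gamma>' = mset \<gamma> \<and> mset (edge_list \<gamma>') = mset (edge_list \<gamma>) \<and>
     last_exit_tree \<gamma>' = last_exit_tree \<gamma> \<and> inner_exits \<gamma>' = inner_exits \<gamma>"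

lemma rerouted_sym: "rerouted \<gamma> \<gamma>' \<Longrightarrow> rerouted \<gamma>' \<gamma>"
  by (auto simp: rerouted_def)

text \<open>Both candidates have the same last-exit tree with the same root, hence the same
  orientation of it. The inner exits complete the stacks, which together with the start determine
  the path.\<close>

lemma rerouted_unique:
  assumes "rerouted \<gamma>\<^sub>1 \<gamma>" "rerouted \<gamma>\<^sub>2 \<gamma>"
  shows "\<gamma>\<^sub>1 = \<gamma>\<^sub>2"
proof (rule path_determined_by_exits)
  show ne: "\<gamma>\<^sub>1 \<noteq> []" "\<gamma>\<^sub>2 \<noteq> []" and "hd \<gamma>\<^sub>1 = hd \<gamma>\<^sub>2"
    using assms by (auto simp: rerouted_def)
  let ?p = "\<lambda>\<gamma> u. last (exits \<gamma> u)"
  have tree: "last_exit_tree \<gamma>\<^sub>1 = last_exit_tree \<gamma>\<^sub>2" and root: "last \<gamma>\<^sub>1 = last \<gamma>\<^sub>2"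
    using assms by (auto simp: rerouted_def)
  then have S: "set \<gamma>\<^sub>1 = set \<gamma>\<^sub>2" by (simp add: last_exit_tree_exits)
  obtain d\<^sub>1 d\<^sub>2 where d: "parent_map (set \<gamma>\<^sub>1) (last \<gamma>\<^sub>1) (?p \<gamma>\<^sub>1) d\<^sub>1"
    "parent_map (set \<gamma>\<^sub>1) (last \<gamma>\<^sub>1) (?p \<gamma>\<^sub>2) d\<^sub>2"
    using parent_map_last_exits ne S root by metis
  have "?p \<gamma>\<^sub>1 u = ?p \<gamma>\<^sub>2 u" if "u \<in> set \<gamma>\<^sub>1 - {last \<gamma>\<^sub>1}" for u
    using d _ that by (rule parent_map_unique) (use tree root S in \<open>simp add: last_exit_tree_exits\<close>)
  moreover have "inner_exits \<gamma>\<^sub>1 u = inner_exits \<gamma>\<^sub>2 u" for u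
    using assms by (simp add: rerouted_def)
  ultimately show "exits \<gamma>\<^sub>1 = exits \<gamma>\<^sub>2"
    using exits_eq_inner_exits[OF ne(1)] exits_eq_inner_exits[OF ne(2)] S root
    by (intro ext) metis
qed

lemma rerouted_exists:
  assumes "\<gamma> \<noteq> []"
  shows "\<exists>\<gamma>'. rerouted \<gamma> \<gamma>'"
proof -
  define S where "S = set \<gamma>"
  define a where "a = hd \<gamma>"
  define b where "b = last \<gamma>"
  define p where "p = (\<lambda>u. last (exits \<gamma> u))"
  have S: "finite S" "a \<in> S" "b \<in> S" using assms by (auto simp: S_def a_def b_def)
  obtain d where "parent_map S b p d"
    using parent_map_last_exits[OF assms] unfolding S_def b_def p_def by blast
  then obtain p' d' where p': "parent_map S a p' d'" "parent_edges S a p' = parent_edges S b p"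
    "image_mset p' (mset_set (S - {a})) + {#b#} = image_mset p (mset_set (S - {b})) + {#a#}"
    using parent_map_reroot S by meson
  \<comment> \<open>The inner exits of \<open>\<gamma>\<close> come first, then the parent exits of
    a tree with root \<open>r\<close>: \<open>stack b p\<close> describes \<open>\<gamma>\<close>,
    and \<open>stack a p'\<close> will describe the rerouted path.\<close>
  define stack where "stack = (\<lambda>r q u. inner_exits \<gamma> u @ (if u \<in> S - {r} then [q u] else []))"
  have exits: "exits \<gamma> = stack b p"
    unfolding stack_def p_def S_def b_def using exits_eq_inner_exits[OF assms] by (intro ext)
  have inner_Nil: "inner_exits \<gamma> u = []" if "u \<notin> S" for u
    using that by (simp add: inner_exits_def S_def exits_notin)
  have sum_ind: "(\<Sum>u\<in>S. if u \<in> S - {r} then {#f u#} else {#}) = image_mset f (mset_set (S - {r}))"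
    for f :: "'a \<Rightarrow> 'c" and r
  proof -
    have "(\<Sum>u\<in>S. if u \<in> S - {r} then {#f u#} else {#}) = (\<Sum>u\<in>S - {r}. {#f u#})"
      using S(1) by (intro sum.mono_neutral_cong_right) auto
    also have "\<dots> = image_mset f (mset_set (S - {r}))"
      using finite_Diff[OF S(1)] by (induction rule: finite_induct) auto
    finally show ?thesis .
  qed
  \<comment> \<open>Two choices of \<open>f\<close> matter: \<open>f u v = v\<close> collects the
    vertices entered and \<open>f u v = {u, v}\<close> the edges crossed.\<close>
  have sum_stack: "(\<Sum>u\<in>S. image_mset (f u) (mset (stack r q u)))
      = (\<Sum>u\<in>S. image_mset (f u) (mset (inner_exits \<gamma> u)))
        + image_mset (\<lambda>u. f u (q u)) (mset_set (S - {r}))" for f :: "'a \<Rightarrow> 'a \<Rightarrow> 'c" and r q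
  proof -
    have "(\<Sum>u\<in>S. image_mset (f u) (mset (stack r q u)))
      = (\<Sum>u\<in>S. image_mset (f u) (mset (inner_exits \<gamma> u))
          + (if u \<in> S - {r} then {#f u (q u)#} else {#}))"
      by (rule sum.cong) (auto simp: stack_def)
    then show ?thesis by (simp only: sum.distrib sum_ind)
  qed
  have total: "(\<Sum>u\<in>S. mset (stack r q u))
      = (\<Sum>u\<in>S. mset (inner_exits \<gamma> u)) + image_mset q (mset_set (S - {r}))" for r q
    using sum_stack[of "\<lambda>_ v. v"] by simp
  have mset_\<gamma>: "mset \<gamma> = (\<Sum>u\<in>S. mset (stack b p u)) + {#a#}"
    using mset_eq_sum_exits[OF S(1) assms] by (simp add: S_def a_def exits)
  \<comment> \<open>The in-degree identity of re-rooting exchanges \<open>a\<close> for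
    \<open>b\<close>: the same visits are now balanced for a walk that starts at
    \<open>b\<close>.\<close>
  then have mset_\<gamma>': "mset \<gamma> = (\<Sum>u\<in>S. mset (stack a p' u)) + {#b#}"
    using p'(3) by (simp add: total ac_simps)
  have length_stack: "length (stack r q u) + of_bool (u = r) = count_list \<gamma> u" if "r \<in> S" for r q u
    using that count_list_0_iff[of \<gamma> u]
    by (cases "u \<in> S") (auto simp: stack_def length_inner_exits S_def Suc_le_eq inner_Nil)
  have "\<exists>\<gamma>'. \<gamma>' \<noteq> [] \<and> hd \<gamma>' = b \<and> last \<gamma>' = a \<and> exits \<gamma>' = stack a p'"
  proof (rule path_with_exits[OF S(1)])
    show "stack a p' u = []" if "u \<notin> S" for u
      using that by (simp add: stack_def inner_Nil)
    \<comment> \<open>Both sides equal the number of visits of \<open>\<gamma>\<close> to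
      \<open>u\<close>, by \<open>length_stack\<close> and \<open>mset_\<gamma>'\<close>.\<close>
    show "length (stack a p' u) + of_bool (u = a)
        = count (\<Sum>v\<in>S. mset (stack a p' v)) u + of_bool (u = b)" for u
      using arg_cong[OF mset_\<gamma>', of "\<lambda>m. count m u"] length_stack[OF S(2), of p' u]
      by (simp add: count_mset)
    show "d' (last (stack a p' u)) < d' u" if "stack a p' u \<noteq> []" "u \<noteq> a" for u
    proof -
      have "u \<in> S" using that inner_Nil[of u] by (auto simp: stack_def split: if_splits)
      with that p'(1) show ?thesis by (simp add: stack_def parent_map_def)
    qed
  qed
  then obtain \<gamma>' where \<gamma>': "\<gamma>' \<noteq> []" "hd \<gamma>' = b" "last \<gamma>' = a" "exits \<gamma>' = stack a p'"
    by blast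
  have count: "count_list \<gamma>' u = count_list \<gamma> u" for u
    using count_list_eq_exits[OF \<gamma>'(1), of u] length_stack[OF S(2), of p' u] \<gamma>' by simp
  then have mset: "mset \<gamma>' = mset \<gamma>"
    by (intro multiset_eqI) (simp add: count_mset)
  then have set: "set \<gamma>' = S" unfolding S_def by (metis set_mset_mset)
  \<comment> \<open>Equal visit counts make \<open>inner_exits\<close> cut the new stacks exactly
    before their tree exits.\<close>
  have inner: "inner_exits \<gamma>' = inner_exits \<gamma>"
    by (rule ext) (simp add: inner_exits_def[of \<gamma>'] count \<gamma>' stack_def length_inner_exits)
  have "last_exit_tree \<gamma>' = (S, set_mset (parent_edges S a p'))"
    using S(1) by (auto simp: last_exit_tree_exits set \<gamma>' stack_def parent_edges_def)
  moreover have "last_exit_tree \<gamma> = (S, set_mset (parent_edges S b p))"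
    using S(1) by (auto simp: last_exit_tree_exits S_def b_def p_def parent_edges_def)
  moreover have "mset (edge_list \<gamma>') = mset (edge_list \<gamma>)"
    using mset_edge_list[OF S(1), of \<gamma>] mset_edge_list[OF S(1), of \<gamma>'] p'(2)
    unfolding set exits \<gamma>' sum_stack parent_edges_def by (simp add: S_def)
  ultimately have "rerouted \<gamma> \<gamma>'"
    using assms \<gamma>' mset inner p'(2) by (simp add: rerouted_def a_def b_def)
  then show ?thesis by blast
qed

text \<open>The reversal restores the endpoints of \<open>\<gamma>\<close> and turns the last-exit
  tree into a first-entrance tree. Existence and uniqueness behind \<open>THE\<close> hold for
  nonempty paths.\<close>

definition reroute :: "'v list \<Rightarrow> 'v list" where
  "reroute \<gamma> = rev (THE \<gamma>'. rerouted \<gamma> \<gamma>')"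

lemma rerouted_reroute:
  assumes "\<gamma> \<noteq> []"
  shows "rerouted \<gamma> (rev (reroute \<gamma>))"
proof -
  have "\<exists>!\<gamma>'. rerouted \<gamma> \<gamma>'"
    using rerouted_exists[OF assms] rerouted_unique rerouted_sym by blast
  then show ?thesis unfolding reroute_def by (simp add: theI')
qed

section \<open>Reversal and the bijection on paths\<close>

lemma edge_list_append: "edge_list (xs @ x # ys) = edge_list (xs @ [x]) @ edge_list (x # ys)"
proof (induction xs)
  case (Cons a xs)
  then show ?case by (cases xs) auto
qed simp

lemma edge_list_rev: "edge_list (rev \<gamma>) = rev (edge_list \<gamma>)"
proof (induction \<gamma> rule: edge_list.induct)
  case (1 x y \<gamma>)
  then show ?case
    using edge_list_append[of "rev \<gamma>" y "[x]"] by (simp add: insert_commute)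
qed auto

lemma
  assumes "\<gamma> \<noteq> []"
  shows reroute_not_Nil: "reroute \<gamma> \<noteq> []"
    and hd_reroute: "hd (reroute \<gamma>) = hd \<gamma>"
    and last_reroute: "last (reroute \<gamma>) = last \<gamma>"
    and mset_reroute: "mset (reroute \<gamma>) = mset \<gamma>"
    and mset_edge_list_reroute: "mset (edge_list (reroute \<gamma>)) = mset (edge_list \<gamma>)"
    and first_entrance_tree_reroute: "first_entrance_tree (reroute \<gamma>) = last_exit_tree \<gamma>"
  using rerouted_reroute[OF assms] first_entrance_tree_rev[of "rev (reroute \<gamma>)"]
  by (auto simp: rerouted_def edge_list_rev hd_rev last_rev)

text \<open>Membership in \<open>P\<close> depends only on visits and crossings, which rerouting
  preserves. Injectivity and surjectivity both come from uniqueness and symmetry of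
  \<open>rerouted\<close>.\<close>

lemma bij_betw_reroute:
  assumes "\<And>\<gamma>. \<gamma> \<in> P \<Longrightarrow> \<gamma> \<noteq> []"
    and "\<And>\<gamma> \<gamma>'. \<gamma> \<noteq> [] \<Longrightarrow> \<gamma>' \<noteq> [] \<Longrightarrow> mset \<gamma>' = mset \<gamma> \<Longrightarrow>
      mset (edge_list \<gamma>') = mset (edge_list \<gamma>) \<Longrightarrow> \<gamma> \<in> P \<longleftrightarrow> \<gamma>' \<in> P"
  shows "bij_betw reroute {\<gamma> \<in> P. last_exit_tree \<gamma> \<in> A} {\<gamma> \<in> P. first_entrance_tree \<gamma> \<in> A}"
    (is "bij_betw _ ?L ?F")
proof -
  have "inj_on reroute ?L"
  proof (rule inj_onI)
    fix \<gamma> \<delta> assume "\<gamma> \<in> ?L" "\<delta> \<in> ?L" "reroute \<gamma> = reroute \<delta>"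
    then show "\<gamma> = \<delta>"
      using assms(1) rerouted_reroute[of \<gamma>] rerouted_reroute[of \<delta>] rerouted_unique by auto
  qed
  moreover have "reroute \<gamma> \<in> ?F" if "\<gamma> \<in> ?L" for \<gamma>
  proof -
    have "\<gamma> \<noteq> []" "\<gamma> \<in> P" using that assms(1) by auto
    then show ?thesis
      using that assms(2)[of \<gamma> "reroute \<gamma>"] reroute_not_Nil mset_reroute mset_edge_list_reroute
        first_entrance_tree_reroute[of \<gamma>] by auto
  qed
  moreover have "\<gamma> \<in> reroute ` ?L" if "\<gamma> \<in> ?F" for \<gamma>
  proof -
    have ne: "\<gamma> \<noteq> []" "\<gamma> \<in> P" using that assms(1) by auto
    \<comment> \<open>The preimage of \<open>\<gamma>\<close>: by symmetry, rerouting
      \<open>\<delta>\<close> gives back \<open>rev \<gamma>\<close>.\<close>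
    then obtain \<delta> where \<delta>: "rerouted (rev \<gamma>) \<delta>" using rerouted_exists[of "rev \<gamma>"] by auto
    then have ne': "\<delta> \<noteq> []" by (simp add: rerouted_def)
    have "rev (reroute \<delta>) = rev \<gamma>"
      using rerouted_reroute[OF ne'] \<delta> by (meson rerouted_sym rerouted_unique)
    then have eq: "\<gamma> = reroute \<delta>" by simp
    have "\<delta> \<in> P"
      using assms(2)[of \<delta> \<gamma>] ne ne' mset_reroute mset_edge_list_reroute eq by blast
    moreover have "last_exit_tree \<delta> \<in> A"
      using first_entrance_tree_reroute[OF ne'] that eq by simp
    ultimately show ?thesis using eq by blast
  qed
  ultimately show ?thesis unfolding bij_betw_def by blast
qed

section \<open>The law of the stopped walk\<close>

lemma edge_list_conv_nth: "edge_list \<gamma> = map (\<lambda>j. {\<gamma> ! j, \<gamma> ! Suc j}) [0..<length \<gamma> - 1]"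
proof (induction \<gamma> rule: edge_list.induct)
  case (1 x y \<gamma>)
  have "[0..<length (x # y # \<gamma>) - 1] = 0 # map Suc [0..<length (y # \<gamma>) - 1]"
    by (simp add: map_Suc_upt upt_conv_Cons del: upt_Suc)
  with 1 show ?case by simp
qed auto

text \<open>Crossings give the numerator and departures the denominator, whatever the order of the
  moves. The final position is not left, hence \<open>butlast\<close>.\<close>

lemma prod_transition_prob:
  assumes "\<gamma> \<noteq> []"
  shows "(\<Prod>i<length \<gamma> - 1. transition_prob E w (\<gamma> ! i) (\<gamma> ! Suc i))
    = (if set (edge_list \<gamma>) \<subseteq> E
       then prod_mset (image_mset w (mset (edge_list \<gamma>)))
         / prod_mset (image_mset (vertex_weight E w) (mset (butlast \<gamma>)))
       else 0)"
  using assms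
proof (induction \<gamma> rule: edge_list.induct)
  case (1 x y \<gamma>)
  have "(\<Prod>i<length (x # y # \<gamma>) - 1.
        transition_prob E w ((x # y # \<gamma>) ! i) ((x # y # \<gamma>) ! Suc i))
      = transition_prob E w x y
        * (\<Prod>i<length (y # \<gamma>) - 1. transition_prob E w ((y # \<gamma>) ! i) ((y # \<gamma>) ! Suc i))"
    by (simp add: prod.lessThan_Suc_shift del: prod.lessThan_Suc)
  then show ?case unfolding "1.IH"[OF list.distinct(2)] by (simp add: transition_prob_def)
qed auto

section \<open>Initial segments of the walk and their crossings\<close>

definition walk_path :: "(nat \<Rightarrow> 'a \<Rightarrow> 'v) \<Rightarrow> nat \<Rightarrow> 'a \<Rightarrow> 'v list" where
  "walk_path X n \<omega> = map (\<lambda>i. X i \<omega>) [0..<Suc n]"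

lemma stopped_path_eq: "stopped_path X \<tau> \<omega> = walk_path X (the_enat (\<tau> \<omega>)) \<omega>"
  by (simp add: stopped_path_def walk_path_def)

lemma length_walk_path [simp]: "length (walk_path X n \<omega>) = Suc n"
  by (simp add: walk_path_def)

lemma walk_path_eq_iff:
  assumes "length \<gamma> = Suc n"
  shows "walk_path X n \<omega> = \<gamma> \<longleftrightarrow> (\<forall>i\<le>n. X i \<omega> = \<gamma> ! i)"
  using assms by (auto simp: walk_path_def list_eq_iff_nth_eq less_Suc_eq_le simp del: upt_Suc)

lemma crossings_eq_count:
  "crossings X e n \<omega> = count (mset (edge_list (walk_path X n \<omega>))) e"
proof -
  have "edge_list (walk_path X n \<omega>) = map (\<lambda>j. {X j \<omega>, X (Suc j) \<omega>}) [0..<n]"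
    unfolding edge_list_conv_nth by (auto simp: walk_path_def simp del: upt_Suc)
  moreover have "{j. j < n \<and> {X j \<omega>, X (Suc j) \<omega>} = e}
      = {i. i < length (map (\<lambda>j. {X j \<omega>, X (Suc j) \<omega>}) [0..<n]) \<and>
          e = map (\<lambda>j. {X j \<omega>, X (Suc j) \<omega>}) [0..<n] ! i}"
    by auto
  ultimately show ?thesis
    by (simp add: crossings_def count_mset count_list_eq_length_filter length_filter_conv_card
        del: mset_map)
qed

text \<open>Events of this form include the generators and are closed under complements and
  countable unions.\<close>

lemma crossing_algebra_representation:
  assumes "B \<in> sets (crossing_algebra M E X T n)"
  shows "\<exists>D. B = {\<omega> \<in> space M. D (T \<omega>) (\<lambda>e. crossings X e n \<omega>)}"
proof -
  define G where "G = {T -` A \<inter> space M |A. True} \<union> {crossings X e n -` A \<inter> space M |e A. e \<in> E}"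
  have "B \<in> sigma_sets (space M) G"
    using assms unfolding crossing_algebra_def G_def by (subst (asm) sets_measure_of) auto
  then show ?thesis
  proof (induction rule: sigma_sets.induct)
    case (Basic B)
    then consider A where "B = T -` A \<inter> space M"
      | e A where "B = crossings X e n -` A \<inter> space M"
      unfolding G_def by blast
    then show ?case
    proof cases
      case 1
      then show ?thesis by (intro exI[of _ "\<lambda>k c. k \<in> A"]) auto
    next
      case 2
      then show ?thesis by (intro exI[of _ "\<lambda>k c. c e \<in> A"]) auto
    qed
  next
    case Empty
    then show ?case by (intro exI[of _ "\<lambda>_ _. False"]) auto
  next
    case (Compl B)
    then obtain D where "B = {\<omega> \<in> space M. D (T \<omega>) (\<lambda>e. crossings X e n \<omega>)}" by blast
    then show ?case by (intro exI[of _ "\<lambda>k c. \<not> D k c"]) auto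
  next
    case (Union B)
    then obtain D where "\<And>i. B i = {\<omega> \<in> space M. D i (T \<omega>) (\<lambda>e. crossings X e n \<omega>)}" by metis
    then show ?case by (intro exI[of _ "\<lambda>k c. \<exists>i. D i k c"]) auto
  qed
qed

section \<open>Path probabilities, independence and measurability\<close>

context network_walk
begin

lemma sets_X_eq: "{\<omega> \<in> space M. X i \<omega> = v} \<in> sets M"
proof -
  \<comment> \<open>The vertex \<open>v\<close> may lie outside \<open>V\<close>, and then
    \<open>{v}\<close> is not a set of \<open>count_space V\<close>.\<close>
  have "{\<omega> \<in> space M. X i \<omega> = v} = X i -` ({v} \<inter> V) \<inter> space M"
    using measurable_space[OF measurable_X] by auto
  also have "\<dots> \<in> sets M" by (rule measurable_sets[OF measurable_X]) auto
  finally show ?thesis .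
qed

lemma sets_path_event: "{\<omega> \<in> space M. \<forall>i\<le>n. X i \<omega> = x i} \<in> sets M"
  using sets.sets_Collect_finite_All[of "{..n}" M "\<lambda>i \<omega>. X i \<omega> = x i"] sets_X_eq by simp

lemma prob_path_event:
  assumes "\<And>i. i \<le> n \<Longrightarrow> x i \<in> V"
  shows "prob {\<omega> \<in> space M. \<forall>i\<le>n. X i \<omega> = x i}
    = prob {\<omega> \<in> space M. X 0 \<omega> = x 0} * (\<Prod>i<n. transition_prob E w (x i) (x (Suc i)))"
  using assms
proof (induction n)
  case (Suc n)
  let ?A = "{\<omega> \<in> space M. \<forall>i\<le>n. X i \<omega> = x i}"
  let ?B = "{\<omega> \<in> space M. \<forall>i\<le>Suc n. X i \<omega> = x i}"
  have IH: "prob ?A = prob {\<omega> \<in> space M. X 0 \<omega> = x 0} * (\<Prod>i<n. transition_prob E w (x i) (x (Suc i)))"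
    using Suc by simp
  have B: "?B = {\<omega> \<in> space M. X (Suc n) \<omega> = x (Suc n) \<and> (\<forall>i\<le>n. X i \<omega> = x i)}"
    by (auto simp: le_Suc_eq)
  have "prob ?B = prob ?A * transition_prob E w (x n) (x (Suc n))"
  proof (cases "prob ?A > 0")
    case True
    with Suc.prems have "\<P>(\<omega> in M. X (Suc n) \<omega> = x (Suc n) \<bar> \<forall>i\<le>n. X i \<omega> = x i)
        = transition_prob E w (x n) (x (Suc n))"
      by (intro markov) auto
    with True show ?thesis unfolding cond_prob_def B by (simp add: field_simps)
  next
    \<comment> \<open>\<open>markov\<close> says nothing after a null prefix; there both sides
      vanish.\<close>
    case False
    then have "prob ?A = 0" by (simp add: zero_less_measure_iff)
    moreover have "prob ?B \<le> prob ?A"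
      by (intro finite_measure_mono sets_path_event) auto
    ultimately show ?thesis by (simp add: measure_le_0_iff)
  qed
  then show ?case using IH by simp
qed simp

lemma walk_path_in_lists: "\<omega> \<in> space M \<Longrightarrow> walk_path X n \<omega> \<in> lists V"
  using measurable_space[OF measurable_X] by (auto simp: walk_path_def)

lemma countable_paths: "countable (lists V)"
  using finite_V by (intro countable_lists countable_finite)

lemma sets_walk_path_eq: "{\<omega> \<in> space M. walk_path X n \<omega> = \<gamma>} \<in> sets M"
proof (cases "length \<gamma> = Suc n")
  case True
  then show ?thesis by (simp add: walk_path_eq_iff sets_path_event)
next
  case False
  then have "{\<omega> \<in> space M. walk_path X n \<omega> = \<gamma>} = {}"
    by (auto dest: arg_cong[of _ _ length])
  then show ?thesis by (simp only: sets.empty_sets)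
qed

lemma measurable_walk_path: "walk_path X n \<in> M \<rightarrow>\<^sub>M count_space (lists V)"
  unfolding measurable_count_space_eq_countable[OF countable_paths]
proof (intro conjI ballI)
  show "walk_path X n -` {\<gamma>} \<inter> space M \<in> sets M" for \<gamma>
    using sets_walk_path_eq[of n \<gamma>] by (simp add: vimage_def Int_def conj_commute)
qed (use walk_path_in_lists in auto)

lemma measurable_crossings: "crossings X e n \<in> M \<rightarrow>\<^sub>M count_space UNIV"
proof -
  have "(\<lambda>\<omega>. count (mset (edge_list (walk_path X n \<omega>))) e) \<in> M \<rightarrow>\<^sub>M count_space UNIV"
    by (rule measurable_compose[OF measurable_walk_path]) simp
  then show ?thesis by (simp add: crossings_eq_count[abs_def])
qed

lemma crossing_algebra_subset:
  assumes "T \<in> M \<rightarrow>\<^sub>M count_space UNIV"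
  shows "sets (crossing_algebra M E X T n) \<subseteq> sets M"
proof -
  have "T -` A \<inter> space M \<in> sets M" "crossings X e n -` A \<inter> space M \<in> sets M" for A e
    using measurable_sets[OF assms] measurable_sets[OF measurable_crossings] by auto
  then show ?thesis
    unfolding crossing_algebra_def
    by (subst sets_measure_of) (auto intro!: sets.sigma_sets_subset)
qed

lemma prob_independent_path_event:
  assumes "independent_of_walk M V X T"
  shows "prob {\<omega> \<in> space M. T \<omega> \<in> A \<and> (\<forall>i\<le>n. X i \<omega> = x i)}
    = prob {\<omega> \<in> space M. T \<omega> \<in> A} * prob {\<omega> \<in> space M. \<forall>i\<le>n. X i \<omega> = x i}"
proof (cases "\<forall>i\<le>n. x i \<in> V")
  case True
  let ?P = "\<Pi>\<^sub>M i\<in>UNIV. count_space V"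
  let ?a = "T -` A \<inter> space M"
  \<comment> \<open>A cylinder in trajectory space, whose preimage under the walk is the path
    event.\<close>
  let ?S = "{f \<in> space ?P. \<forall>i\<in>{..n}. f i = x i}"
  let ?b = "(\<lambda>\<omega> i. X i \<omega>) -` ?S \<inter> space M"
  have "?a \<in> sets (vimage_algebra (space M) T (count_space UNIV))"
    by (rule in_vimage_algebra) simp
  moreover have "?S \<in> sets ?P"
  proof (rule sets.sets_Collect_finite_All)
    fix i assume "i \<in> {..n}"
    have "(\<lambda>f. f i) -` {x i} \<inter> space ?P \<in> sets ?P"
      by (rule measurable_sets[OF measurable_component_singleton]) (use True \<open>i \<in> _\<close> in auto)
    then show "{f \<in> space ?P. f i = x i} \<in> sets ?P"
      by (simp add: vimage_def Int_def conj_commute)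
  qed simp
  then have "?b \<in> sets (vimage_algebra (space M) (\<lambda>\<omega> i. X i \<omega>) ?P)"
    by (rule in_vimage_algebra)
  ultimately have "prob (?a \<inter> ?b) = prob ?a * prob ?b"
    using assms unfolding independent_of_walk_def by (rule indep_setD[rotated 1])
  moreover have "?b = {\<omega> \<in> space M. \<forall>i\<le>n. X i \<omega> = x i}"
    using measurable_space[OF measurable_X] by (auto simp: space_PiM PiE_def)
  moreover have "?a = {\<omega> \<in> space M. T \<omega> \<in> A}" by auto
  moreover have "?a \<inter> {\<omega> \<in> space M. \<forall>i\<le>n. X i \<omega> = x i}
      = {\<omega> \<in> space M. T \<omega> \<in> A \<and> (\<forall>i\<le>n. X i \<omega> = x i)}" by auto
  ultimately show ?thesis by simp
next
  case False
  \<comment> \<open>The walk never leaves \<open>V\<close>, so both sides are 0.\<close>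
  then have "\<not> (\<forall>i\<le>n. X i \<omega> = x i)" if "\<omega> \<in> space M" for \<omega>
    using measurable_space[OF measurable_X that] by (metis space_count_space)
  then have "{\<omega> \<in> space M. \<forall>i\<le>n. X i \<omega> = x i} = {}"
    "{\<omega> \<in> space M. T \<omega> \<in> A \<and> (\<forall>i\<le>n. X i \<omega> = x i)} = {}" by auto
  then show ?thesis by (simp only: measure_empty mult_zero_right)
qed

text \<open>Since \<open>the_enat \<infinity>\<close> is one fixed natural number, points with
  infinite \<open>\<tau>\<close> have their path cut at that time, and the event of infinite
  \<open>\<tau>\<close> has to be measurable too.\<close>

lemma measurable_stopped_path:
  assumes "\<And>n. {\<omega> \<in> space M. \<tau> \<omega> = enat n} \<in> sets M"
  shows "stopped_path X \<tau> \<in> M \<rightarrow>\<^sub>M count_space (lists V)"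
  unfolding measurable_count_space_eq_countable[OF countable_paths]
proof (intro conjI ballI)
  fix \<gamma> :: "'v list"
  let ?n = "length \<gamma> - 1"
  let ?I = "{\<omega> \<in> space M. \<tau> \<omega> = \<infinity>}"
  have "?I = space M - (\<Union>n. {\<omega> \<in> space M. \<tau> \<omega> = enat n})" by auto
  then have I: "?I \<in> sets M" using assms by auto
  have "{\<omega> \<in> space M. the_enat (\<tau> \<omega>) = n}
      = {\<omega> \<in> space M. \<tau> \<omega> = enat n} \<union> (if the_enat \<infinity> = n then ?I else {})" for n
  proof -
    have "the_enat t = n \<longleftrightarrow> t = enat n \<or> the_enat \<infinity> = n \<and> t = \<infinity>" for t
      by (cases t) simp_all
    then show ?thesis
      by (cases "the_enat \<infinity> = n") (simp_all add: Collect_disj_eq[symmetric] conj_disj_distribL)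
  qed
  then have "{\<omega> \<in> space M. the_enat (\<tau> \<omega>) = ?n} \<in> sets M" using assms I by simp
  then have "{\<omega> \<in> space M. the_enat (\<tau> \<omega>) = ?n} \<inter> {\<omega> \<in> space M. walk_path X ?n \<omega> = \<gamma>} \<in> sets M"
    using sets_walk_path_eq by blast
  also have "{\<omega> \<in> space M. the_enat (\<tau> \<omega>) = ?n} \<inter> {\<omega> \<in> space M. walk_path X ?n \<omega> = \<gamma>}
      = stopped_path X \<tau> -` {\<gamma>} \<inter> space M"
    by (auto simp: stopped_path_eq)
  finally show "stopped_path X \<tau> -` {\<gamma>} \<inter> space M \<in> sets M" .
qed (use walk_path_in_lists in \<open>auto simp: stopped_path_eq\<close>)

text \<open>Once the walk starts with \<open>\<gamma>\<close>, its crossing counts are known and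
  stopping there is a condition on \<open>T\<close> alone. It sees \<open>\<gamma>\<close> only
  through length and crossings, which rerouting preserves.\<close>

lemma prob_stopped_path:
  assumes T: "T \<in> M \<rightarrow>\<^sub>M count_space UNIV"
    and indep: "independent_of_walk M V X T"
    and finite: "AE \<omega> in M. \<tau> \<omega> \<noteq> \<infinity>"
    and crossings: "\<And>n. {\<omega> \<in> space M. \<tau> \<omega> = enat n} \<in> sets (crossing_algebra M E X T n)"
  shows "\<exists>D. \<forall>\<gamma>\<in>lists V - {[]}.
    prob (stopped_path X \<tau> -` {\<gamma>} \<inter> space M)
      = prob {\<omega> \<in> space M. T \<omega> \<in> D (length \<gamma>) (mset (edge_list \<gamma>))}
        * (prob {\<omega> \<in> space M. X 0 \<omega> = hd \<gamma>}
        * (\<Prod>i<length \<gamma> - 1. transition_prob E w (\<gamma> ! i) (\<gamma> ! Suc i)))"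
proof -
  have "\<forall>n. \<exists>D. {\<omega> \<in> space M. \<tau> \<omega> = enat n} = {\<omega> \<in> space M. D (T \<omega>) (\<lambda>e. crossings X e n \<omega>)}"
    by (intro allI crossing_algebra_representation[OF crossings])
  from choice[OF this] obtain D where D: "{\<omega> \<in> space M. \<tau> \<omega> = enat n}
      = {\<omega> \<in> space M. D n (T \<omega>) (\<lambda>e. crossings X e n \<omega>)}" for n
    by blast
  have stopped: "\<tau> \<omega> = enat n \<longleftrightarrow> D n (T \<omega>) (count (mset (edge_list (walk_path X n \<omega>))))"
    if "\<omega> \<in> space M" for n \<omega>
    using D[of n] that unfolding crossings_eq_count by blast
  have sets_\<tau>: "{\<omega> \<in> space M. \<tau> \<omega> = enat n} \<in> sets M" for n
    using crossings crossing_algebra_subset[OF T] by blast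
  show ?thesis
  \<comment> \<open>A list of \<open>l\<close> vertices makes \<open>l - 1\<close> steps, and
    \<open>l - 1\<close> is the stopping time.\<close>
  proof (rule exI[of _ "\<lambda>l m. {k. D (l - 1) k (count m)}"], rule ballI)
    fix \<gamma> assume "\<gamma> \<in> lists V - {[]}"
    then have \<gamma>: "\<gamma> \<in> lists V" "\<gamma> \<noteq> []" by auto
    define n where "n = length \<gamma> - 1"
    have n: "length \<gamma> = Suc n" using \<gamma>(2) by (simp add: n_def)
    let ?A = "{k. D n k (count (mset (edge_list \<gamma>)))}"
    have T_A: "{\<omega> \<in> space M. T \<omega> \<in> ?A} \<in> sets M"
      using measurable_sets[OF T, of ?A] by (simp add: vimage_def Int_def conj_commute)
    \<comment> \<open>Where \<open>\<tau>\<close> is infinite the equivalence may fail; those points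
      are null and are absorbed by \<open>finite_measure_eq_AE\<close>.\<close>
    have eq: "stopped_path X \<tau> \<omega> = \<gamma> \<longleftrightarrow> T \<omega> \<in> ?A \<and> (\<forall>i\<le>n. X i \<omega> = \<gamma> ! i)"
      if \<omega>: "\<omega> \<in> space M" "\<tau> \<omega> \<noteq> \<infinity>" for \<omega>
    proof -
      obtain m where m: "\<tau> \<omega> = enat m" using \<omega>(2) by auto
      have "stopped_path X \<tau> \<omega> = \<gamma> \<longleftrightarrow> \<tau> \<omega> = enat n \<and> walk_path X n \<omega> = \<gamma>"
        using n m by (auto simp: stopped_path_eq)
      also have "\<dots> \<longleftrightarrow> T \<omega> \<in> ?A \<and> walk_path X n \<omega> = \<gamma>"
        using stopped[OF \<omega>(1), of n] by auto
      finally show ?thesis by (simp add: walk_path_eq_iff[OF n])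
    qed
    have "{\<omega> \<in> space M. T \<omega> \<in> ?A \<and> (\<forall>i\<le>n. X i \<omega> = \<gamma> ! i)}
        = {\<omega> \<in> space M. T \<omega> \<in> ?A} \<inter> {\<omega> \<in> space M. \<forall>i\<le>n. X i \<omega> = \<gamma> ! i}" by auto
    also have "\<dots> \<in> sets M" using T_A sets_path_event by blast
    finally have "prob (stopped_path X \<tau> -` {\<gamma>} \<inter> space M)
        = prob {\<omega> \<in> space M. T \<omega> \<in> ?A \<and> (\<forall>i\<le>n. X i \<omega> = \<gamma> ! i)}"
      using measurable_sets[OF measurable_stopped_path[OF sets_\<tau>], of "{\<gamma>}"] \<gamma>(1) finite eq
      by (intro finite_measure_eq_AE) (auto elim!: AE_mp)
    also have "\<dots> = prob {\<omega> \<in> space M. T \<omega> \<in> ?A} * prob {\<omega> \<in> space M. \<forall>i\<le>n. X i \<omega> = \<gamma> ! i}"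
      by (rule prob_independent_path_event[OF indep])
    also have "prob {\<omega> \<in> space M. \<forall>i\<le>n. X i \<omega> = \<gamma> ! i}
        = prob {\<omega> \<in> space M. X 0 \<omega> = hd \<gamma>}
          * (\<Prod>i<n. transition_prob E w (\<gamma> ! i) (\<gamma> ! Suc i))"
      using prob_path_event[of n "\<lambda>i. \<gamma> ! i"] \<gamma> n by (auto simp: hd_conv_nth)
    finally show "prob (stopped_path X \<tau> -` {\<gamma>} \<inter> space M)
      = prob {\<omega> \<in> space M. T \<omega> \<in> {k. D (length \<gamma> - 1) k (count (mset (edge_list \<gamma>)))}}
        * (prob {\<omega> \<in> space M. X 0 \<omega> = hd \<gamma>}
        * (\<Prod>i<length \<gamma> - 1. transition_prob E w (\<gamma> ! i) (\<gamma> ! Suc i)))"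
      unfolding n_def .
  qed
qed

end

theorem proposition2p6:
  fixes V :: "'v set" and E :: "'v set set" and w :: "'v set \<Rightarrow> real"
    and M :: "'a measure" and X :: "nat \<Rightarrow> 'a \<Rightarrow> 'v"
    and T :: "'a \<Rightarrow> nat" and \<tau> :: "'a \<Rightarrow> enat"
  assumes walk: "network_walk V E w M X"
    and T_measurable: "T \<in> M \<rightarrow>\<^sub>M count_space UNIV"
    and T_indep: "independent_of_walk M V X T"
    and tau_stopping: "stopping_time (walk_filtration M X T) \<tau>"
    and tau_finite: "AE \<omega> in M. \<tau> \<omega> \<noteq> \<infinity>"
    and tau_crossings:
      "\<And>n. {\<omega> \<in> space M. \<tau> \<omega> = enat n} \<in> sets (crossing_algebra M E X T n)"
  shows "distr M (count_space UNIV) (\<lambda>\<omega>. first_entrance_tree (stopped_path X \<tau> \<omega>))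
       = distr M (count_space UNIV) (\<lambda>\<omega>. last_exit_tree (stopped_path X \<tau> \<omega>))"
proof (rule measure_eqI)
  interpret network_walk V E w M X by (rule walk)
  let ?N = "distr M (count_space (lists V)) (stopped_path X \<tau>)"
  let ?P = "lists V - {[]}"
  have meas: "stopped_path X \<tau> \<in> M \<rightarrow>\<^sub>M count_space (lists V)"
    using tau_crossings crossing_algebra_subset[OF T_measurable] by (intro measurable_stopped_path) blast
  from prob_stopped_path[OF T_measurable T_indep tau_finite tau_crossings]
  obtain D where D: "\<forall>\<gamma>\<in>?P.
    prob (stopped_path X \<tau> -` {\<gamma>} \<inter> space M)
      = prob {\<omega> \<in> space M. T \<omega> \<in> D (length \<gamma>) (mset (edge_list \<gamma>))}
        * (prob {\<omega> \<in> space M. X 0 \<omega> = hd \<gamma>}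
        * (\<Prod>i<length \<gamma> - 1. transition_prob E w (\<gamma> ! i) (\<gamma> ! Suc i)))" ..
  have reroute_in: "reroute \<gamma> \<in> ?P" if "\<gamma> \<in> ?P" for \<gamma>
    using that reroute_not_Nil[of \<gamma>] mset_reroute[of \<gamma>] by (auto simp: in_lists_conv_set dest: mset_eq_setD)
  have invariant: "emeasure ?N {reroute \<gamma>} = emeasure ?N {\<gamma>}" if "\<gamma> \<in> ?P" for \<gamma>
  proof -
    have ne: "\<gamma> \<noteq> []" using that by simp
    \<comment> \<open>The final vertex is shared, so equal visits give equal denominators in
      \<open>prod_transition_prob\<close>.\<close>
    have "mset (butlast \<delta>) + {#last \<delta>#} = mset \<delta>" if "\<delta> \<noteq> []" for \<delta> :: "'v list"
      using arg_cong[OF append_butlast_last_id[OF that], of mset] by simp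
    from this[OF ne] this[OF reroute_not_Nil[OF ne]]
    have "mset (butlast (reroute \<gamma>)) + {#last \<gamma>#} = mset (butlast \<gamma>) + {#last \<gamma>#}"
      by (simp add: mset_reroute[OF ne] last_reroute[OF ne])
    then have "mset (butlast (reroute \<gamma>)) = mset (butlast \<gamma>)" by simp
    moreover have "set (edge_list (reroute \<gamma>)) = set (edge_list \<gamma>)" "length (reroute \<gamma>) = length \<gamma>"
      using mset_edge_list_reroute[OF ne] mset_reroute[OF ne] by (metis mset_eq_setD, metis mset_eq_length)
    ultimately have "prob (stopped_path X \<tau> -` {reroute \<gamma>} \<inter> space M)
        = prob (stopped_path X \<tau> -` {\<gamma>} \<inter> space M)"
      unfolding D[THEN bspec, OF that] D[THEN bspec, OF reroute_in[OF that]]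
        prod_transition_prob[OF ne] prod_transition_prob[OF reroute_not_Nil[OF ne]]
      by (simp add: mset_edge_list_reroute[OF ne] hd_reroute[OF ne])
    then show ?thesis
      using that reroute_in[OF that] by (simp add: emeasure_distr[OF meas] emeasure_eq_measure)
  qed
  \<comment> \<open>A set of trees pulls back to a countable set of paths, so its probability is a
    sum of singleton masses. Stopped paths have at least one vertex and hence lie in
    \<open>?P\<close>.\<close>
  have tree: "emeasure (distr M (count_space UNIV) (\<lambda>\<omega>. f (stopped_path X \<tau> \<omega>))) A
      = (\<integral>\<^sup>+\<gamma>. emeasure ?N {\<gamma>} \<partial>count_space {\<gamma> \<in> ?P. f \<gamma> \<in> A})" for f :: "'v list \<Rightarrow> 'v subgraph" and A
  proof -
    have "emeasure (distr M (count_space UNIV) (\<lambda>\<omega>. f (stopped_path X \<tau> \<omega>))) A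
        = emeasure M ((\<lambda>\<omega>. f (stopped_path X \<tau> \<omega>)) -` A \<inter> space M)"
      by (rule emeasure_distr, rule measurable_compose[OF meas]) auto
    also have "(\<lambda>\<omega>. f (stopped_path X \<tau> \<omega>)) -` A \<inter> space M
        = stopped_path X \<tau> -` {\<gamma> \<in> ?P. f \<gamma> \<in> A} \<inter> space M"
      using measurable_space[OF meas] by (auto simp: stopped_path_def)
    also have "emeasure M \<dots> = emeasure ?N {\<gamma> \<in> ?P. f \<gamma> \<in> A}"
      by (rule emeasure_distr[OF meas, symmetric]) auto
    also have "\<dots> = (\<integral>\<^sup>+\<gamma>. emeasure ?N {\<gamma>} \<partial>count_space {\<gamma> \<in> ?P. f \<gamma> \<in> A})"
      by (intro emeasure_countable_singleton countable_subset[OF _ countable_paths]) auto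
    finally show ?thesis .
  qed
  fix A
  have "bij_betw reroute {\<gamma> \<in> ?P. last_exit_tree \<gamma> \<in> A} {\<gamma> \<in> ?P. first_entrance_tree \<gamma> \<in> A}"
    by (rule bij_betw_reroute) (auto simp: in_lists_conv_set dest: mset_eq_setD)
  \<comment> \<open>Change of variables along the bijection; \<open>invariant\<close> then removes
    \<open>reroute\<close>.\<close>
  then have "(\<integral>\<^sup>+\<gamma>. emeasure ?N {\<gamma>} \<partial>count_space {\<gamma> \<in> ?P. first_entrance_tree \<gamma> \<in> A})
      = (\<integral>\<^sup>+\<gamma>. emeasure ?N {reroute \<gamma>} \<partial>count_space {\<gamma> \<in> ?P. last_exit_tree \<gamma> \<in> A})"
    by (rule nn_integral_bij_count_space[symmetric])
  also have "\<dots> = (\<integral>\<^sup>+\<gamma>. emeasure ?N {\<gamma>} \<partial>count_space {\<gamma> \<in> ?P. last_exit_tree \<gamma> \<in> A})"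
    by (intro nn_integral_cong invariant) simp
  finally show "emeasure (distr M (count_space UNIV) (\<lambda>\<omega>. first_entrance_tree (stopped_path X \<tau> \<omega>))) A
      = emeasure (distr M (count_space UNIV) (\<lambda>\<omega>. last_exit_tree (stopped_path X \<tau> \<omega>))) A"
    unfolding tree .
qed simp

end
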